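(* Let $\mathscr{A}$ be a finite-dimensional real Jordan algebra and let $\langle\cdot,\cdot\rangle$ be an inner product on $\mathscr{A}$. Then $(\mathscr{A},\langle\cdot,\cdot\rangle)$ admits a unique Jordan-Levi-Civita connection $\nabla$, and it is given by $$\langle\nabla_X Y, Z\rangle=\frac{1}{2}\bigl(\langle XY, Z\rangle-\langle YZ, X\rangle+\langle ZX, Y\rangle\bigr)\quad\text{for all } X,Y,Z\in\mathscr{A}.$$
   Context: A (real) Jordan algebra is a real vector space $\mathscr{A}$ with a bilinear product satisfying $XY=YX$ and $X(X^2Y)=X^2(XY)$ for all $X,Y\in\mathscr{A}$. A metric Jordan algebra $(\mathscr{A},\langle\cdot,\cdot\rangle)$ is a Jordan algebra with an arbitrary (positive definite, symmetric) inner product on the underlying vector space. A connection on $\mathscr{A}$ is a bilinear map $\nabla:\mathscr{A}\times\mathscr{A}\to\mathscr{A}$, written $\nabla_XY:=\nabla(X,Y)$. It is torsion-free if $\nabla_XY+\nabla_YX=XY$ for all $X,Y\in\mathscr{A}$. A Jordan-Levi-Civita connection on $(\mathscr{A},\langle\cdot,\cdot\rangle)$ is a torsion-free connection such that $\langle\nabla_XY,Z\rangle-\langle Y,\nabla_XZ\rangle=0$ for all $X,Y,Z\in\mathscr{A}$. *)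

theory Defs
  imports "HOL-Analysis.Analysis"
begin

text \<open>
  The product, the inner product and the connection are explicit functions on a real vector space
  type, so that one algebra can carry arbitrary inner products. Finite dimensionality is an
  explicit predicate because the class \<open>euclidean_space\<close> fixes an inner product and excludes
  dimension 0.
\<close>

definition finite_dimensional :: "'a::real_vector itself \<Rightarrow> bool" where
  "finite_dimensional _ \<longleftrightarrow>
     (\<exists>B :: 'a set. finite_dimensional_vector_space ((*\<^sub>R) :: real \<Rightarrow> 'a \<Rightarrow> 'a) B)"

definition jordan_algebra :: "('a::real_vector \<Rightarrow> 'a \<Rightarrow> 'a) \<Rightarrow> bool" where
  "jordan_algebra mul \<longleftrightarrow>
     bilinear mul \<and>
     (\<forall>X Y. mul X Y = mul Y X) \<and>
     (\<forall>X Y. mul X (mul (mul X X) Y) = mul (mul X X) (mul X Y))"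

definition inner_product :: "('a::real_vector \<Rightarrow> 'a \<Rightarrow> real) \<Rightarrow> bool" where
  "inner_product ip \<longleftrightarrow>
     bilinear ip \<and>
     (\<forall>X Y. ip X Y = ip Y X) \<and>
     (\<forall>X. X \<noteq> 0 \<longrightarrow> ip X X > 0)"

definition connection :: "('a::real_vector \<Rightarrow> 'a \<Rightarrow> 'a) \<Rightarrow> bool" where
  "connection nabla \<longleftrightarrow> bilinear nabla"

definition torsion_free :: "('a::real_vector \<Rightarrow> 'a \<Rightarrow> 'a) \<Rightarrow> ('a \<Rightarrow> 'a \<Rightarrow> 'a) \<Rightarrow> bool" where
  "torsion_free mul nabla \<longleftrightarrow> (\<forall>X Y. nabla X Y + nabla Y X = mul X Y)"

definition jordan_levi_civita ::
  "('a::real_vector \<Rightarrow> 'a \<Rightarrow> 'a) \<Rightarrow> ('a \<Rightarrow> 'a \<Rightarrow> real) \<Rightarrow> ('a \<Rightarrow> 'a \<Rightarrow> 'a) \<Rightarrow> bool" where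
  "jordan_levi_civita mul ip nabla \<longleftrightarrow>
     connection nabla \<and>
     torsion_free mul nabla \<and>
     (\<forall>X Y Z. ip (nabla X Y) Z - ip Y (nabla X Z) = 0)"

end

theory Submission
  imports Defs
begin

text \<open>
  As for the Levi-Civita connection of Riemannian geometry, everything is contained in a Koszul
  formula. Every operator \<open>\<nabla>\<^sub>X\<close> is self-adjoint, so the trilinear form \<open>\<langle>\<nabla>\<^sub>X Y, Z\<rangle>\<close> is symmetric in
  its last two arguments, while torsion-freeness prescribes its symmetrization in the first two.
  These two conditions can be solved for the form, and this is \<open>koszul_formula\<close>.
  Uniqueness follows, because an inner product separates vectors.

  For existence, the right-hand side of the formula is linear in \<open>Z\<close>, so in finite dimension
  it is represented by a vector, which is taken as \<open>\<nabla>\<^sub>X Y\<close> (\<open>riesz_representation\<close>).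
  Bilinearity, torsion-freeness and self-adjointness are then identities between values of
  the trilinear form.
\<close>

lemma bilinear_rules:
  assumes "bilinear f"
  shows "f (x + y) z = f x z + f y z" "f z (x + y) = f z x + f z y"
    "f (c *\<^sub>R x) z = c *\<^sub>R f x z" "f z (c *\<^sub>R x) = c *\<^sub>R f z x"
    "f (x - y) z = f x z - f y z" "f z (x - y) = f z x - f z y"
  by (fact bilinear_ladd[OF assms] bilinear_radd[OF assms] bilinear_lmul[OF assms]
      bilinear_rmul[OF assms] bilinear_lsub[OF assms] bilinear_rsub[OF assms])+

lemma inner_product_separates:
  assumes "inner_product ip" and eq: "\<And>z. ip u z = ip v z"
  shows "u = v"
proof -
  have "bilinear ip" using assms(1) by (simp add: inner_product_def)
  hence "ip (u - v) (u - v) = 0" by (simp add: bilinear_rules(5) eq)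
  thus "u = v" using assms(1) unfolding inner_product_def
    by (metis less_irrefl right_minus_eq)
qed

text \<open>
  The induction is one Gram-Schmidt step: the induction hypothesis is used once for \<open>f\<close> itself and
  once for \<open>ip x\<close>, whose representing vector is the orthogonal projection of the new
  vector \<open>x\<close> to the old span. For this to be the projection, the representing vector has to be
  found inside the span.
\<close>

lemma riesz_on_finite_set:
  fixes ip :: "'a::real_vector \<Rightarrow> 'a \<Rightarrow> real"
  assumes ip: "inner_product ip" and "finite S" and "linear f"
  shows "\<exists>v\<in>span S. \<forall>z\<in>S. ip v z = f z"
  using \<open>finite S\<close> \<open>linear f\<close>
proof (induction S arbitrary: f rule: finite_induct)
  case empty
  show ?case by (auto intro: span_zero)
next
  case (insert x S)
  have bil: "bilinear ip"
    and pos: "\<And>a. a \<noteq> 0 \<Longrightarrow> ip a a > 0"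
    using ip by (auto simp: inner_product_def)
  have lin: "linear (ip a)" for a using bil by (simp add: bilinear_def)
  obtain v where v: "v \<in> span S" "\<And>z. z \<in> S \<Longrightarrow> ip v z = f z"
    using insert.IH[OF insert.prems] by blast
  obtain u where u: "u \<in> span S" "\<And>z. z \<in> S \<Longrightarrow> ip u z = ip x z"
    using insert.IH[OF lin] by blast
  have on_span: "ip v z = f z" "ip u z = ip x z" if "z \<in> span S" for z
    using linear_eq_on_span[OF lin insert.prems v(2) that]
      linear_eq_on_span[OF lin lin u(2) that] by simp_all
  define w where "w = x - u"
  have w_orth: "ip w z = 0" if "z \<in> span S" for z
    using on_span(2)[OF that] by (simp add: w_def bilinear_rules[OF bil])
  have sub: "span S \<subseteq> span (insert x S)" by (rule span_mono) auto
  have "w \<in> span (insert x S)"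
    unfolding w_def using u(1) sub by (metis insertI1 span_base span_diff subsetD)
  show ?case
  proof (cases "w = 0")
    case True
    hence "x \<in> span S" using u(1) by (simp add: w_def)
    hence "\<forall>z\<in>insert x S. ip v z = f z" using v(2) on_span(1) by auto
    thus ?thesis using v(1) sub by blast
  next
    case False
    have "ip w x = ip w w + ip w u" by (simp add: w_def bilinear_rules[OF bil])
    hence wx: "ip w x > 0" using pos[OF False] w_orth[OF u(1)] by simp
    \<comment> \<open>Adding a multiple of \<open>w\<close> keeps the values on \<open>S\<close>; the multiple corrects the value at \<open>x\<close>.\<close>
    define v' where "v' = v + ((f x - ip v x) / ip w x) *\<^sub>R w"
    have "v' \<in> span (insert x S)"
      unfolding v'_def using v(1) sub \<open>w \<in> span (insert x S)\<close>
      by (intro span_add span_scale) auto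
    moreover have "ip v' x = f x"
      using wx by (simp add: v'_def bilinear_rules[OF bil])
    moreover have "ip v' z = f z" if "z \<in> S" for z
      using v(2)[OF that] w_orth[OF span_base[OF that]]
      by (simp add: v'_def bilinear_rules[OF bil])
    ultimately show ?thesis by blast
  qed
qed

lemma riesz_representation:
  fixes ip :: "'a::real_vector \<Rightarrow> 'a \<Rightarrow> real"
  assumes "finite_dimensional TYPE('a)" and ip: "inner_product ip" and f: "linear f"
  shows "\<exists>v. \<forall>z. ip v z = f z"
proof -
  obtain B :: "'a set" where fd: "finite_dimensional_vector_space ((*\<^sub>R) :: real \<Rightarrow> 'a \<Rightarrow> 'a) B"
    using assms(1) by (auto simp: finite_dimensional_def)
  have "finite B" and span: "span B = UNIV"
    using finite_dimensional_vector_space.finite_Basis[OF fd]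
      finite_dimensional_vector_space.span_Basis[OF fd] by (simp_all add: span_raw_def)
  obtain v where v: "\<And>z. z \<in> B \<Longrightarrow> ip v z = f z"
    using riesz_on_finite_set[OF ip \<open>finite B\<close> f] by blast
  have "linear (ip v)" using ip by (simp add: inner_product_def bilinear_def)
  hence "ip v z = f z" for z
    using f by (rule linear_eq_on_span[where B = B]) (simp_all add: v span)
  thus ?thesis by blast
qed

text \<open>
  Expanding the three products by torsion-freeness gives six terms, which self-adjointness
  identifies in pairs; the signs make two of the three pairs cancel.
\<close>

lemma koszul_formula:
  assumes "inner_product ip" and lc: "jordan_levi_civita mul ip nabla"
  shows "ip (nabla X Y) Z = 1 / 2 * (ip (mul X Y) Z - ip (mul Y Z) X + ip (mul Z X) Y)"
proof -
  have bil: "bilinear ip" and sym: "\<And>a b. ip a b = ip b a"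
    using assms(1) by (auto simp: inner_product_def)
  have tor: "\<And>a b. mul a b = nabla a b + nabla b a"
    and adj: "\<And>a b c. ip (nabla a b) c = ip b (nabla a c)"
    using lc by (auto simp: jordan_levi_civita_def torsion_free_def)
  have swap: "ip (nabla a b) c = ip (nabla a c) b" for a b c
    using adj[of a b c] sym by simp
  show ?thesis
    using swap[of X Y Z] swap[of Y Z X] swap[of Z X Y]
    by (simp add: tor bilinear_rules[OF bil])
qed

lemma jordan_levi_civita_exists:
  fixes mul :: "'a::real_vector \<Rightarrow> 'a \<Rightarrow> 'a"
  assumes "finite_dimensional TYPE('a)" and mul: "bilinear mul"
    and comm: "\<And>X Y. mul X Y = mul Y X" and ip: "inner_product ip"
  shows "\<exists>nabla. jordan_levi_civita mul ip nabla"
proof -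
  have bil: "bilinear ip" and sym: "\<And>a b. ip a b = ip b a"
    using ip by (auto simp: inner_product_def)
  note rules = bilinear_rules[OF bil] bilinear_rules[OF mul]
  define K where "K X Y Z = 1 / 2 * (ip (mul X Y) Z - ip (mul Y Z) X + ip (mul Z X) Y)"
    for X Y Z
  have "linear (K X Y)" for X Y
    by (rule linearI) (simp_all add: K_def rules algebra_simps)
  hence "\<exists>v. \<forall>Z. ip v Z = K X Y Z" for X Y
    by (rule riesz_representation[OF assms(1) ip])
  then obtain nabla where nabla: "\<And>X Y Z. ip (nabla X Y) Z = K X Y Z"
    by metis
  have "bilinear nabla"
    unfolding bilinear_def
    by (intro conjI allI linearI; rule inner_product_separates[OF ip])
      (simp_all add: nabla rules K_def algebra_simps)
  moreover have "nabla X Y + nabla Y X = mul X Y" for X Y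
    by (rule inner_product_separates[OF ip])
      (simp add: nabla rules K_def comm field_simps)
  moreover have "ip (nabla X Y) Z - ip Y (nabla X Z) = 0" for X Y Z
    by (simp add: sym[of Y "nabla X Z"] nabla K_def comm)
  ultimately show ?thesis
    unfolding jordan_levi_civita_def connection_def torsion_free_def by blast
qed

theorem theorem3p4:
  fixes mul :: "'a::real_vector \<Rightarrow> 'a \<Rightarrow> 'a"
    and ip :: "'a \<Rightarrow> 'a \<Rightarrow> real"
  assumes "finite_dimensional TYPE('a)"
    and "jordan_algebra mul"
    and "inner_product ip"
  shows "(\<exists>!nabla. jordan_levi_civita mul ip nabla) \<and>
    (\<forall>nabla. jordan_levi_civita mul ip nabla \<longrightarrow>
      (\<forall>X Y Z. ip (nabla X Y) Z
         = 1 / 2 * (ip (mul X Y) Z - ip (mul Y Z) X + ip (mul Z X) Y)))"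
proof -
  have "bilinear mul" "\<And>X Y. mul X Y = mul Y X"
    using assms(2) by (auto simp: jordan_algebra_def)
  hence "\<exists>nabla. jordan_levi_civita mul ip nabla"
    by (rule jordan_levi_civita_exists[OF assms(1) _ _ assms(3)])
  moreover have "nabla = nabla'"
    if "jordan_levi_civita mul ip nabla" "jordan_levi_civita mul ip nabla'" for nabla nabla'
    by (intro ext inner_product_separates[OF assms(3)])
      (simp add: koszul_formula[OF assms(3) that(1)] koszul_formula[OF assms(3) that(2)])
  ultimately show ?thesis
    using koszul_formula[OF assms(3)] by blast
qed

end
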